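(* (i) Let $\psi_{*}\in\Psi$ with $\Pi_{\Psi}(\{\psi_{*}\})<1$. Using the principle of evidence, the prior probability of getting evidence in favor of $\psi_{*}$ when it is true is greater than or equal to the prior probability of getting evidence in favor of $\psi_{*}$ given that $\psi_{*}$ is false, i.e. $$M(RB_{\Psi}(\psi_{*}\,|\,X)>1\,|\,\psi_{*})\;\geq\;\frac{1}{\Pi_{\Psi}(\{\psi_{*}\}^{c})}\int_{\Psi\backslash\{\psi_{*}\}}M(RB_{\Psi}(\psi_{*}\,|\,X)>1\,|\,\psi)\,\Pi_{\Psi}(d\psi).$$ (ii) Suppose $\Pi_{\Psi}(\{\psi_{*}\})<1$ for every $\psi_{*}\in\Psi$, and let $Pl_{\Psi}(x)=\{\psi\in\Psi:RB_{\Psi}(\psi\,|\,x)>1\}$. Then the prior probability of $Pl_{\Psi}$ covering the true value is greater than or equal to the prior probability of $Pl_{\Psi}$ covering a false value, i.e. $$\int_{\Psi}M(\psi_{*}\in Pl_{\Psi}(X)\,|\,\psi_{*})\,\Pi_{\Psi}(d\psi_{*})\;\geq\;\int_{\Psi}\frac{1}{\Pi_{\Psi}(\{\psi_{*}\}^{c})}\int_{\Psi\backslash\{\psi_{*}\}}M(\psi_{*}\in Pl_{\Psi}(X)\,|\,\psi)\,\Pi_{\Psi}(d\psi)\,\Pi_{\Psi}(d\psi_{*}).$$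
   Context: Setting. $\{f_{\theta}:\theta\in\Theta\}$ is a statistical model of probability densities for data $x\in\mathcal{X}$ with respect to a common $\sigma$-finite support measure $\mu$ on $\mathcal{X}$, with $f_\theta(x)$ jointly measurable. $\Pi$ is a proper prior (a probability measure) on $\Theta$. $\Psi:\Theta\rightarrow\Psi$ is a measurable map that is onto (the same symbol denotes the map and its range), and $\psi=\Psi(\theta)$ is the quantity of interest. $\Pi_{\Psi}$ is the marginal prior of $\psi$ (singletons, and the diagonal of $\Psi\times\Psi$, are measurable), and $\Pi(\cdot\,|\,\psi)$ is the conditional prior of $\theta$ given $\Psi(\theta)=\psi$, a regular conditional probability. Prior predictives. $m(x)=\int_{\Theta}f_{\theta}(x)\,\Pi(d\theta)$ is the prior predictive density and $M(B)=\int_{B}m(x)\,\mu(dx)$. The conditional prior predictive density given $\psi$ is $m(x\,|\,\psi)=\int_{\Theta}f_{\theta}(x)\,\Pi(d\theta\,|\,\psi)$, jointly measurable in $(x,\psi)$, and $M(B\,|\,\psi)=\int_{B}m(x\,|\,\psi)\,\mu(dx)$. Thus $M(B)=\int_{\Psi}M(B\,|\,\psi)\,\Pi_{\Psi}(d\psi)$. Relative belief ratio. $RB_{\Psi}(\psi\,|\,x)$ is the ratio of the posterior density to the prior density of $\psi$, which equals $m(x\,|\,\psi)/m(x)$. The conditions $RB_{\Psi}(\psi\,|\,x)\le 1$, $<1$, $\ge 1$, $>1$ mean respectively $m(x\,|\,\psi)\le m(x)$, $<$, $\ge$, $>$. Principle of evidence: there is evidence in favor of $\psi$ when $RB_{\Psi}(\psi\,|\,x)>1$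 and evidence against $\psi$ when $RB_{\Psi}(\psi\,|\,x)<1$. Here $M(\psi_{*}\in Pl_{\Psi}(X)\,|\,\psi)=M(\{x:\psi_{*}\in Pl_{\Psi}(x)\}\,|\,\psi)$. *)

theory Defs
  imports "HOL-Probability.Probability"
begin

text \<open>
  The prior \<open>P\<close> is a probability measure on the parameter space, \<open>\<mu>\<close> is the support measure on
  the data space, and \<open>f \<theta> x\<close> is the density of the model at data \<open>x\<close>.  The quantity of interest is
  \<open>\<psi> = Y \<theta>\<close> with values in the measurable space \<open>N\<close>, of which only \<open>space N\<close> and \<open>sets N\<close> matter.
  \<open>K \<psi>\<close> is the conditional prior of \<open>\<theta>\<close> given \<open>Y \<theta> = \<psi>\<close>.
\<close>

definition marginal_prior :: "'t measure \<Rightarrow> 'p measure \<Rightarrow> ('t \<Rightarrow> 'p) \<Rightarrow> 'p measure" where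
  "marginal_prior P N Y = distr P N Y"

text \<open>
  Concentration of \<open>K \<psi>\<close> on the fibre over \<open>\<psi>\<close> is not demanded for every single \<open>\<psi>\<close>.  When the
  diagonal is measurable, as below, it holds for almost all \<open>\<psi>\<close>.
\<close>

definition regular_conditional_prob ::
    "'t measure \<Rightarrow> 'p measure \<Rightarrow> ('t \<Rightarrow> 'p) \<Rightarrow> ('p \<Rightarrow> 't measure) \<Rightarrow> bool" where
  "regular_conditional_prob P N Y K \<longleftrightarrow>
     K \<in> N \<rightarrow>\<^sub>M prob_algebra P \<and>
     (\<forall>A\<in>sets P. \<forall>B\<in>sets N.
        emeasure P (A \<inter> (Y -` B \<inter> space P))
          = (\<integral>\<^sup>+\<psi>\<in>B. emeasure (K \<psi>) A \<partial>marginal_prior P N Y))"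

locale relative_belief_model =
  prior: prob_space P + support: sigma_finite_measure \<mu>
  for P :: "'t measure" and \<mu> :: "'x measure" +
  fixes N :: "'p measure"
    and f :: "'t \<Rightarrow> 'x \<Rightarrow> real"
    and Y :: "'t \<Rightarrow> 'p"
    and K :: "'p \<Rightarrow> 't measure"
  assumes f_measurable: "(\<lambda>(\<theta>, x). f \<theta> x) \<in> borel_measurable (P \<Otimes>\<^sub>M \<mu>)"
    and f_nonneg: "\<And>\<theta> x. \<theta> \<in> space P \<Longrightarrow> x \<in> space \<mu> \<Longrightarrow> 0 \<le> f \<theta> x"
    and f_density: "\<And>\<theta>. \<theta> \<in> space P \<Longrightarrow> (\<integral>\<^sup>+x. ennreal (f \<theta> x) \<partial>\<mu>) = 1"
    and Y_measurable: "Y \<in> P \<rightarrow>\<^sub>M N"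
    and Y_onto: "Y ` space P = space N"
    and singleton_sets: "\<And>\<psi>. \<psi> \<in> space N \<Longrightarrow> {\<psi>} \<in> sets N"
    and diagonal_sets: "{p \<in> space (N \<Otimes>\<^sub>M N). fst p = snd p} \<in> sets (N \<Otimes>\<^sub>M N)"
    and K_conditional: "regular_conditional_prob P N Y K"

text \<open>
  Both predictives are instances of the same mixture: mixing over \<open>P\<close> gives \<open>m(x)\<close> and \<open>M\<close>, mixing
  over \<open>K \<psi>\<close> gives \<open>m(x | \<psi>)\<close> and \<open>M(\<cdot> | \<psi>)\<close>.  The densities may be infinite on a \<open>\<mu>\<close>-null set.
\<close>

definition predictive_density :: "('t \<Rightarrow> 'x \<Rightarrow> real) \<Rightarrow> 't measure \<Rightarrow> 'x \<Rightarrow> ennreal" where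
  "predictive_density f Q x = (\<integral>\<^sup>+\<theta>. ennreal (f \<theta> x) \<partial>Q)"

definition predictive :: "'x measure \<Rightarrow> ('t \<Rightarrow> 'x \<Rightarrow> real) \<Rightarrow> 't measure \<Rightarrow> 'x measure" where
  "predictive \<mu> f Q = density \<mu> (predictive_density f Q)"

text \<open>
  The posterior-to-prior density ratio \<open>m(x | \<psi>) / m(x)\<close>.  Equal densities have ratio 1 also when
  both are 0 or both are infinite, so that comparing the ratio with 1 always amounts to comparing
  \<open>m(x | \<psi>)\<close> with \<open>m(x)\<close>.
\<close>

definition rel_belief ::
    "('t \<Rightarrow> 'x \<Rightarrow> real) \<Rightarrow> 't measure \<Rightarrow> ('p \<Rightarrow> 't measure) \<Rightarrow> 'p \<Rightarrow> 'x \<Rightarrow> ennreal" where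
  "rel_belief f P K \<psi> x =
     (if predictive_density f (K \<psi>) x = predictive_density f P x then 1
      else predictive_density f (K \<psi>) x / predictive_density f P x)"

definition plausible_region ::
    "('t \<Rightarrow> 'x \<Rightarrow> real) \<Rightarrow> 't measure \<Rightarrow> 'p measure \<Rightarrow> ('p \<Rightarrow> 't measure) \<Rightarrow> 'x \<Rightarrow> 'p set" where
  "plausible_region f P N K x = {\<psi> \<in> space N. rel_belief f P K \<psi> x > 1}"

lemma ennreal_less_divide_one:
  fixes a b :: ennreal
  assumes "a \<noteq> b"
  shows "1 < a / b \<longleftrightarrow> b < a" and "a / b < 1 \<longleftrightarrow> a < b"
proof -
  consider "b = 0" | "b = \<top>" | r where "b = ennreal r" "0 < r"
    by (cases b) (auto simp: less_eq_real_def)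
  then have "(1 < a / b \<longleftrightarrow> b < a) \<and> (a / b < 1 \<longleftrightarrow> a < b)"
  proof cases
    case 1
    then show ?thesis
      using assms by (auto simp: ennreal_divide_zero zero_less_iff_neq_zero)
  next
    case 2
    then show ?thesis
      using assms by (auto simp: less_top)
  next
    case 3
    then show ?thesis
      by (cases a) (auto simp: divide_ennreal ennreal_top_divide ennreal_less_iff
          simp flip: ennreal_1)
  qed
  then show "1 < a / b \<longleftrightarrow> b < a" and "a / b < 1 \<longleftrightarrow> a < b"
    by auto
qed

lemma rel_belief_gt_1_iff:
  "1 < rel_belief f P K \<psi> x \<longleftrightarrow> predictive_density f P x < predictive_density f (K \<psi>) x"
  by (auto simp: rel_belief_def ennreal_less_divide_one)

lemma rel_belief_lt_1_iff:
  "rel_belief f P K \<psi> x < 1 \<longleftrightarrow> predictive_density f (K \<psi>) x < predictive_density f P x"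
  by (auto simp: rel_belief_def ennreal_less_divide_one)

definition posterior :: "('t \<Rightarrow> 'x \<Rightarrow> real) \<Rightarrow> 't measure \<Rightarrow> 'x \<Rightarrow> 't measure" where
  "posterior f P x = density P (\<lambda>\<theta>. ennreal (f \<theta> x) / predictive_density f P x)"

context relative_belief_model
begin

lemma sets_K: "\<psi> \<in> space N \<Longrightarrow> sets (K \<psi>) = sets P"
  using K_conditional measurable_space[of K N "prob_algebra P" \<psi>]
  by (auto simp: regular_conditional_prob_def space_prob_algebra)

lemma prob_space_marginal_prior: "prob_space (marginal_prior P N Y)"
  unfolding marginal_prior_def by (rule prior.prob_space_distr[OF Y_measurable])

lemma measurable_predictive_density_K:
  "(\<lambda>(\<psi>, x). predictive_density f (K \<psi>) x) \<in> borel_measurable (N \<Otimes>\<^sub>M \<mu>)"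
proof -
  have K: "K \<in> N \<rightarrow>\<^sub>M subprob_algebra P"
    using K_conditional measurable_prob_algebraD
    by (auto simp: regular_conditional_prob_def)
  have "(\<lambda>p. \<integral>\<^sup>+\<theta>. ennreal (f \<theta> (snd p)) \<partial>K (fst p)) \<in> borel_measurable (N \<Otimes>\<^sub>M \<mu>)"
  proof (rule nn_integral_measurable_subprob_algebra2[where N = P])
    have "(\<lambda>q. (\<lambda>(\<theta>, x). f \<theta> x) (snd q, snd (fst q)))
            \<in> borel_measurable ((N \<Otimes>\<^sub>M \<mu>) \<Otimes>\<^sub>M P)"
      by (rule measurable_compose[OF _ f_measurable]) measurable
    then show "(\<lambda>(p, \<theta>). ennreal (f \<theta> (snd p))) \<in> borel_measurable ((N \<Otimes>\<^sub>M \<mu>) \<Otimes>\<^sub>M P)"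
      by (simp add: case_prod_beta')
    show "(\<lambda>p. K (fst p)) \<in> N \<Otimes>\<^sub>M \<mu> \<rightarrow>\<^sub>M subprob_algebra P"
      by (rule measurable_compose[OF measurable_fst K])
  qed
  then show ?thesis
    by (simp add: predictive_density_def case_prod_beta')
qed

lemma nn_integral_disintegration:
  assumes g: "g \<in> borel_measurable P" and B: "B \<in> sets N"
  shows "(\<integral>\<^sup>+\<theta>\<in>Y -` B \<inter> space P. g \<theta> \<partial>P)
           = (\<integral>\<^sup>+\<psi>\<in>B. (\<integral>\<^sup>+\<theta>. g \<theta> \<partial>K \<psi>) \<partial>marginal_prior P N Y)"
proof -
  let ?Q = "marginal_prior P N Y"
  let ?D = "density ?Q (indicator B)"
  have K: "K \<in> N \<rightarrow>\<^sub>M subprob_algebra P"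
    using K_conditional measurable_prob_algebraD
    by (auto simp: regular_conditional_prob_def)
  have sQ: "sets ?Q = sets N"
    by (simp add: marginal_prior_def)
  have KD: "K \<in> ?D \<rightarrow>\<^sub>M subprob_algebra P"
    using K by (simp cong: measurable_cong_sets add: sQ)
  have ne: "space ?D \<noteq> {}"
    using Y_onto prior.not_empty by (auto simp: marginal_prior_def)
  have YB: "Y -` B \<inter> space P \<in> sets P"
    using Y_measurable B by (rule measurable_sets)
  have BQ: "B \<in> sets ?Q"
    using B by (simp add: sQ)
  have eq: "density P (indicator (Y -` B \<inter> space P)) = ?D \<bind> K"
  proof (rule measure_eqI)
    show "sets (density P (indicator (Y -` B \<inter> space P))) = sets (?D \<bind> K)"
      using sets_bind[of ?D K P] ne sets_K by (auto simp: marginal_prior_def)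
    fix A assume "A \<in> sets (density P (indicator (Y -` B \<inter> space P)))"
    then have A: "A \<in> sets P" by simp
    have meas: "(\<lambda>\<psi>. emeasure (K \<psi>) A) \<in> borel_measurable ?Q"
      using measurable_compose[OF K measurable_emeasure_subprob_algebra[OF A]]
      by (simp cong: measurable_cong_sets add: sQ)
    have "emeasure (?D \<bind> K) A = (\<integral>\<^sup>+\<psi>. emeasure (K \<psi>) A \<partial>?D)"
      by (rule emeasure_bind[OF ne KD A])
    also have "\<dots> = (\<integral>\<^sup>+\<psi>. indicator B \<psi> * emeasure (K \<psi>) A \<partial>?Q)"
      by (rule nn_integral_density) (use meas BQ in auto)
    also have "\<dots> = emeasure P (A \<inter> (Y -` B \<inter> space P))"
      using K_conditional A B by (simp add: regular_conditional_prob_def mult.commute)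
    also have "\<dots> = emeasure (density P (indicator (Y -` B \<inter> space P))) A"
      using A YB by (simp add: emeasure_density Int_commute flip: indicator_inter_arith)
    finally show "emeasure (density P (indicator (Y -` B \<inter> space P))) A = emeasure (?D \<bind> K) A"
      by simp
  qed
  have int: "(\<lambda>\<psi>. \<integral>\<^sup>+\<theta>. g \<theta> \<partial>K \<psi>) \<in> borel_measurable ?Q"
    using measurable_compose[OF K nn_integral_measurable_subprob_algebra[OF g]]
    by (simp cong: measurable_cong_sets add: sQ)
  have "(\<integral>\<^sup>+\<theta>\<in>Y -` B \<inter> space P. g \<theta> \<partial>P) = (\<integral>\<^sup>+\<theta>. g \<theta> \<partial>(?D \<bind> K))"
    unfolding eq[symmetric] using g YB by (subst nn_integral_density) (auto simp: mult.commute)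
  also have "\<dots> = (\<integral>\<^sup>+\<psi>. (\<integral>\<^sup>+\<theta>. g \<theta> \<partial>K \<psi>) \<partial>?D)"
    by (rule nn_integral_bind[OF g KD])
  also have "\<dots> = (\<integral>\<^sup>+\<psi>\<in>B. (\<integral>\<^sup>+\<theta>. g \<theta> \<partial>K \<psi>) \<partial>?Q)"
    using int BQ by (subst nn_integral_density) (auto simp: mult.commute)
  finally show ?thesis .
qed

lemma rel_belief_is_density_ratio:
  assumes x: "x \<in> space \<mu>" "0 < predictive_density f P x" "predictive_density f P x < \<top>"
  shows "distr (posterior f P x) N Y = density (marginal_prior P N Y) (\<lambda>\<psi>. rel_belief f P K \<psi> x)"
proof (rule measure_eqI)
  let ?m = "predictive_density f P x" and ?Q = "marginal_prior P N Y"
  show "sets (distr (posterior f P x) N Y)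
          = sets (density ?Q (\<lambda>\<psi>. rel_belief f P K \<psi> x))"
    by (simp add: marginal_prior_def)
  fix B assume "B \<in> sets (distr (posterior f P x) N Y)"
  then have B: "B \<in> sets N" by simp
  have fx: "(\<lambda>\<theta>. ennreal (f \<theta> x)) \<in> borel_measurable P"
    using measurable_compose[OF measurable_Pair2'[OF x(1)] f_measurable] by simp
  have rb: "rel_belief f P K \<psi> x = predictive_density f (K \<psi>) x / ?m" for \<psi>
    using x by (simp add: rel_belief_def)
  have mK: "(\<lambda>\<psi>. predictive_density f (K \<psi>) x) \<in> borel_measurable ?Q"
    using measurable_compose[OF measurable_Pair2'[OF x(1)] measurable_predictive_density_K]
    by (simp add: marginal_prior_def)
  have "emeasure (distr (posterior f P x) N Y) B
      = emeasure (posterior f P x) (Y -` B \<inter> space P)"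
    using Y_measurable B by (subst emeasure_distr) (auto simp: posterior_def)
  also have "\<dots> = (\<integral>\<^sup>+\<theta>\<in>Y -` B \<inter> space P. (ennreal (f \<theta> x) / ?m) \<partial>P)"
    unfolding posterior_def
    by (rule emeasure_density) (use fx measurable_sets[OF Y_measurable B] in auto)
  also have "\<dots> = (\<integral>\<^sup>+\<psi>\<in>B. (\<integral>\<^sup>+\<theta>. ennreal (f \<theta> x) / ?m \<partial>K \<psi>) \<partial>?Q)"
    by (rule nn_integral_disintegration) (use fx B in auto)
  also have "\<dots> = (\<integral>\<^sup>+\<psi>\<in>B. rel_belief f P K \<psi> x \<partial>?Q)"
  proof (rule nn_integral_cong)
    fix \<psi> assume "\<psi> \<in> space ?Q"
    then have "\<psi> \<in> space N" by (simp add: marginal_prior_def)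
    then have "(\<lambda>\<theta>. ennreal (f \<theta> x)) \<in> borel_measurable (K \<psi>)"
      using fx by (simp cong: measurable_cong_sets add: sets_K)
    then show "(\<integral>\<^sup>+\<theta>. ennreal (f \<theta> x) / ?m \<partial>K \<psi>) * indicator B \<psi>
        = rel_belief f P K \<psi> x * indicator B \<psi>"
      by (simp add: rb predictive_density_def nn_integral_divide)
  qed
  also have "\<dots> = emeasure (density ?Q (\<lambda>\<psi>. rel_belief f P K \<psi> x)) B"
    unfolding rb using mK B by (subst emeasure_density) (auto simp: marginal_prior_def)
  finally show "emeasure (distr (posterior f P x) N Y) B
      = emeasure (density ?Q (\<lambda>\<psi>. rel_belief f P K \<psi> x)) B" .
qed

end

end

theory Submission
  imports Defs
begin

text \<open>
  On the set \<open>A\<close> where there is evidence in favour of \<open>\<psi>\<^sub>0\<close> the density \<open>m(x | \<psi>\<^sub>0)\<close> exceeds \<open>m(x)\<close>,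
  so \<open>M(A) \<le> M(A | \<psi>\<^sub>0)\<close>.  As \<open>M(A)\<close> is the average of \<open>M(A | \<psi>\<^sub>0)\<close> and of the mean of \<open>M(A | \<psi>)\<close>
  over \<open>\<psi> \<noteq> \<psi>\<^sub>0\<close>, with weights \<open>\<Pi>({\<psi>\<^sub>0})\<close> and \<open>1 - \<Pi>({\<psi>\<^sub>0})\<close>, that mean is at most \<open>M(A | \<psi>\<^sub>0)\<close>.
  Integrating over \<open>\<psi>\<^sub>0\<close> gives the statement on the plausible region.
\<close>

context relative_belief_model
begin

lemma sets_marginal_prior [simp]: "sets (marginal_prior P N Y) = sets N"
  and space_marginal_prior [simp]: "space (marginal_prior P N Y) = space N"
  by (simp_all add: marginal_prior_def)

lemma prob_space_K: "\<psi> \<in> space N \<Longrightarrow> prob_space (K \<psi>)"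
  using K_conditional measurable_space[of K N "prob_algebra P" \<psi>]
  by (auto simp: regular_conditional_prob_def space_prob_algebra)

text \<open>Measurability depends only on the sigma-algebra, so allowing any \<open>Q\<close> with
  the sets of \<open>P\<close> serves the prior and every \<open>K \<psi>\<close> at once.\<close>

lemma f_measurable_pair:
  assumes "sets Q = sets P"
  shows "(\<lambda>(\<theta>, x). ennreal (f \<theta> x)) \<in> borel_measurable (Q \<Otimes>\<^sub>M \<mu>)"
proof -
  have "(\<lambda>p. ennreal ((\<lambda>(\<theta>, x). f \<theta> x) p)) \<in> borel_measurable (P \<Otimes>\<^sub>M \<mu>)"
    using f_measurable by measurable
  then show ?thesis
    using assms by (simp add: case_prod_beta' cong: measurable_cong_sets sets_pair_measure_cong)
qed

lemma measurable_predictive_density: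
  assumes "prob_space Q" "sets Q = sets P"
  shows "predictive_density f Q \<in> borel_measurable \<mu>"
proof -
  interpret Q: prob_space Q by fact
  have "(\<lambda>(x, \<theta>). ennreal (f \<theta> x)) \<in> borel_measurable (\<mu> \<Otimes>\<^sub>M Q)"
    \<comment> \<open>The parameter must be the second coordinate, since that is the one
      \<open>borel_measurable_nn_integral\<close> integrates out.\<close>
    using measurable_pair_swap[OF f_measurable_pair[OF assms(2)]] by (simp add: case_prod_beta')
  then have "(\<lambda>x. \<integral>\<^sup>+\<theta>. ennreal (f \<theta> x) \<partial>Q) \<in> borel_measurable \<mu>"
    by (rule Q.borel_measurable_nn_integral)
  then show ?thesis
    by (simp add: predictive_density_def[abs_def])
qed

lemma emeasure_predictive:
  assumes "prob_space Q" "sets Q = sets P" "A \<in> sets \<mu>"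
  shows "emeasure (predictive \<mu> f Q) A = (\<integral>\<^sup>+x\<in>A. predictive_density f Q x \<partial>\<mu>)"
  unfolding predictive_def
  by (rule emeasure_density[OF measurable_predictive_density[OF assms(1,2)] assms(3)])

text \<open>Tonelli: every \<open>f \<theta>\<close> integrates to 1, hence so does its mixture over
  \<open>Q\<close>. The finiteness obtained here later permits cancellation in
  \<open>ennreal\<close>.\<close>

lemma prob_space_predictive:
  assumes "prob_space Q" "sets Q = sets P"
  shows "prob_space (predictive \<mu> f Q)"
proof
  interpret Q: prob_space Q by fact
  interpret pair_sigma_finite Q \<mu> ..
  have "emeasure (predictive \<mu> f Q) (space \<mu>) = (\<integral>\<^sup>+x. predictive_density f Q x \<partial>\<mu>)"
    by (subst emeasure_predictive[OF assms]) (auto intro!: nn_integral_cong)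
  also have "\<dots> = (\<integral>\<^sup>+\<theta>. (\<integral>\<^sup>+x. ennreal (f \<theta> x) \<partial>\<mu>) \<partial>Q)"
    unfolding predictive_density_def
    by (rule Fubini'[OF f_measurable_pair[OF assms(2)]])
  also have "\<dots> = (\<integral>\<^sup>+\<theta>. 1 \<partial>Q)"
    using sets_eq_imp_space_eq[OF assms(2)] by (intro nn_integral_cong) (simp add: f_density)
  finally show "emeasure (predictive \<mu> f Q) (space (predictive \<mu> f Q)) = 1"
    by (simp add: predictive_def Q.emeasure_space_1)
qed

text \<open>This is the disintegration of the prior with \<open>B = space N\<close>, whose preimage
  under \<open>Y\<close> is all of \<open>space P\<close>. It holds at every data point, with
  infinite values allowed.\<close>

lemma predictive_density_mixture:
  assumes x: "x \<in> space \<mu>"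
  shows "predictive_density f P x = (\<integral>\<^sup>+\<psi>. predictive_density f (K \<psi>) x \<partial>marginal_prior P N Y)"
proof -
  have fx: "(\<lambda>\<theta>. ennreal (f \<theta> x)) \<in> borel_measurable P"
    using measurable_compose[OF measurable_Pair2'[OF x] f_measurable] by simp
  have "predictive_density f P x = (\<integral>\<^sup>+\<theta>\<in>Y -` space N \<inter> space P. ennreal (f \<theta> x) \<partial>P)"
    unfolding predictive_density_def
    using Y_onto by (intro nn_integral_cong) (auto split: split_indicator)
  also have "\<dots> = (\<integral>\<^sup>+\<psi>\<in>space N. (\<integral>\<^sup>+\<theta>. ennreal (f \<theta> x) \<partial>K \<psi>) \<partial>marginal_prior P N Y)"
    by (rule nn_integral_disintegration[OF fx]) simp
  also have "\<dots> = (\<integral>\<^sup>+\<psi>. predictive_density f (K \<psi>) x \<partial>marginal_prior P N Y)"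
    unfolding predictive_density_def by (intro nn_integral_cong) simp
  finally show ?thesis .
qed

lemma measurable_predictive_density_K_marginal:
  "(\<lambda>(\<psi>, x). predictive_density f (K \<psi>) x) \<in> borel_measurable (marginal_prior P N Y \<Otimes>\<^sub>M \<mu>)"
  using measurable_predictive_density_K
  by (simp cong: measurable_cong_sets sets_pair_measure_cong)

lemma measurable_emeasure_predictive_K:
  assumes A: "A \<in> sets \<mu>"
  shows "(\<lambda>\<psi>. emeasure (predictive \<mu> f (K \<psi>)) A) \<in> borel_measurable (marginal_prior P N Y)"
proof -
  have "(\<lambda>(\<psi>, x). predictive_density f (K \<psi>) x * indicator A x)
      \<in> borel_measurable (marginal_prior P N Y \<Otimes>\<^sub>M \<mu>)"
    using measurable_predictive_density_K_marginal A
    by (auto simp: case_prod_beta' intro!: borel_measurable_times_ennreal)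
  then have "(\<lambda>\<psi>. \<integral>\<^sup>+x\<in>A. predictive_density f (K \<psi>) x \<partial>\<mu>) \<in> borel_measurable (marginal_prior P N Y)"
    by (rule support.borel_measurable_nn_integral)
  then show ?thesis
    by (rule iffD1[OF measurable_cong, rotated])
      (simp add: emeasure_predictive A prob_space_K sets_K)
qed

text \<open>The law of total probability for the predictives: integrate the mixture formula for the
  densities over \<open>A\<close> and exchange the two integrals by Tonelli.\<close>

lemma emeasure_predictive_mixture:
  assumes A: "A \<in> sets \<mu>"
  shows "emeasure (predictive \<mu> f P) A
    = (\<integral>\<^sup>+\<psi>. emeasure (predictive \<mu> f (K \<psi>)) A \<partial>marginal_prior P N Y)"
proof -
  let ?Q = "marginal_prior P N Y"
  interpret Q: prob_space ?Q by (rule prob_space_marginal_prior)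
  interpret pair_sigma_finite ?Q \<mu> ..
  have meas: "(\<lambda>(\<psi>, x). predictive_density f (K \<psi>) x * indicator A x) \<in> borel_measurable (?Q \<Otimes>\<^sub>M \<mu>)"
    using measurable_predictive_density_K_marginal A
    by (auto simp: case_prod_beta' intro!: borel_measurable_times_ennreal)
  \<comment> \<open>Measurability at fixed \<open>x\<close> lets the factor
    \<open>indicator A x\<close>, constant in \<open>\<psi>\<close>, move inside the integral over
    \<open>\<psi>\<close>.\<close>
  have slice: "(\<lambda>\<psi>. predictive_density f (K \<psi>) x) \<in> borel_measurable ?Q" if "x \<in> space \<mu>" for x
    using measurable_compose[OF measurable_Pair2'[OF that] measurable_predictive_density_K_marginal]
    by simp
  have "emeasure (predictive \<mu> f P) A = (\<integral>\<^sup>+x\<in>A. predictive_density f P x \<partial>\<mu>)"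
    by (rule emeasure_predictive[OF prior.prob_space_axioms refl A])
  also have "\<dots> = (\<integral>\<^sup>+x. (\<integral>\<^sup>+\<psi>. predictive_density f (K \<psi>) x * indicator A x \<partial>?Q) \<partial>\<mu>)"
    by (intro nn_integral_cong) (simp add: predictive_density_mixture slice nn_integral_multc)
  also have "\<dots> = (\<integral>\<^sup>+\<psi>. (\<integral>\<^sup>+x\<in>A. predictive_density f (K \<psi>) x \<partial>\<mu>) \<partial>?Q)"
    by (rule Fubini'[OF meas])
  also have "\<dots> = (\<integral>\<^sup>+\<psi>. emeasure (predictive \<mu> f (K \<psi>)) A \<partial>?Q)"
    by (intro nn_integral_cong) (simp add: emeasure_predictive A prob_space_K sets_K)
  finally show ?thesis .
qed

text \<open>Comparing the ratio with 1 is comparing two measurable densities, so the division and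
  the special case of equal densities drop out.\<close>

lemma evidence_in_favor_set:
  assumes "\<psi>\<^sub>0 \<in> space N"
  shows "{x \<in> space \<mu>. rel_belief f P K \<psi>\<^sub>0 x > 1} \<in> sets \<mu>"
proof -
  have [measurable]: "predictive_density f P \<in> borel_measurable \<mu>"
    "predictive_density f (K \<psi>\<^sub>0) \<in> borel_measurable \<mu>"
    using assms by (simp_all add: measurable_predictive_density prob_space_K sets_K prior.prob_space_axioms)
  show ?thesis
    unfolding rel_belief_gt_1_iff by measurable
qed

lemma predictive_le_conditional_predictive:
  assumes \<psi>\<^sub>0: "\<psi>\<^sub>0 \<in> space N"
  defines "A \<equiv> {x \<in> space \<mu>. rel_belief f P K \<psi>\<^sub>0 x > 1}"
  shows "emeasure (predictive \<mu> f P) A \<le> emeasure (predictive \<mu> f (K \<psi>\<^sub>0)) A"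
proof -
  have A: "A \<in> sets \<mu>"
    unfolding A_def by (rule evidence_in_favor_set[OF \<psi>\<^sub>0])
  have "(\<integral>\<^sup>+x\<in>A. predictive_density f P x \<partial>\<mu>) \<le> (\<integral>\<^sup>+x\<in>A. predictive_density f (K \<psi>\<^sub>0) x \<partial>\<mu>)"
    by (intro nn_integral_mono) (auto simp: A_def rel_belief_gt_1_iff split: split_indicator)
  then show ?thesis
    by (simp add: emeasure_predictive A \<psi>\<^sub>0 prob_space_K sets_K prior.prob_space_axioms)
qed

lemma evidence_in_favor_true_ge_false:
  assumes \<psi>\<^sub>0: "\<psi>\<^sub>0 \<in> space N" and lt1: "emeasure (marginal_prior P N Y) {\<psi>\<^sub>0} < 1"
  defines "A \<equiv> {x \<in> space \<mu>. rel_belief f P K \<psi>\<^sub>0 x > 1}"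
  shows "1 / emeasure (marginal_prior P N Y) (space N - {\<psi>\<^sub>0}) *
      (\<integral>\<^sup>+\<psi>\<in>space N - {\<psi>\<^sub>0}. emeasure (predictive \<mu> f (K \<psi>)) A \<partial>marginal_prior P N Y)
    \<le> emeasure (predictive \<mu> f (K \<psi>\<^sub>0)) A"
proof -
  let ?Q = "marginal_prior P N Y"
  let ?M = "\<lambda>\<psi>. emeasure (predictive \<mu> f (K \<psi>)) A"
  define p where "p = emeasure ?Q {\<psi>\<^sub>0}"
  define q where "q = emeasure ?Q (space N - {\<psi>\<^sub>0})"
  define I where "I = (\<integral>\<^sup>+\<psi>\<in>space N - {\<psi>\<^sub>0}. ?M \<psi> \<partial>?Q)"
  interpret Q: prob_space ?Q by (rule prob_space_marginal_prior)
  interpret M0: prob_space "predictive \<mu> f (K \<psi>\<^sub>0)"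
    by (intro prob_space_predictive prob_space_K sets_K \<psi>\<^sub>0)
  have sing: "{\<psi>\<^sub>0} \<in> sets ?Q" using singleton_sets[OF \<psi>\<^sub>0] by simp
  have A: "A \<in> sets \<mu>"
    unfolding A_def by (rule evidence_in_favor_set[OF \<psi>\<^sub>0])
  have meas: "?M \<in> borel_measurable ?Q"
    by (rule measurable_emeasure_predictive_K[OF A])
  have pq: "p + q = 1"
    using plus_emeasure[OF sing sets.compl_sets[OF sing]] \<psi>\<^sub>0 Q.emeasure_space_1
    by (simp add: p_def q_def insert_absorb)
  \<comment> \<open>If \<open>q\<close> were 0, then \<open>p\<close> would be 1, against
    \<open>lt1\<close>.\<close>
  have q: "q \<noteq> 0" "q \<noteq> \<top>"
    using pq lt1 by (auto simp: p_def q_def)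
  have "(\<integral>\<^sup>+\<psi>. ?M \<psi> \<partial>?Q) = (\<integral>\<^sup>+\<psi>. ?M \<psi> * indicator {\<psi>\<^sub>0} \<psi> + ?M \<psi> * indicator (space N - {\<psi>\<^sub>0}) \<psi> \<partial>?Q)"
    by (intro nn_integral_cong) (auto split: split_indicator)
  also have "\<dots> = ?M \<psi>\<^sub>0 * p + I"
    unfolding I_def p_def using sing sets.compl_sets[OF sing]
    by (subst nn_integral_add)
      (auto simp: nn_integral_indicator_singleton
        intro!: borel_measurable_times_ennreal meas borel_measurable_indicator)
  \<comment> \<open>The left side is the predictive probability of \<open>A\<close>, and the right
    side is \<open>?M \<psi>\<^sub>0\<close> because \<open>p + q = 1\<close>.\<close>
  finally have "?M \<psi>\<^sub>0 * p + I \<le> ?M \<psi>\<^sub>0 * p + ?M \<psi>\<^sub>0 * q"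
    using predictive_le_conditional_predictive[OF \<psi>\<^sub>0, folded A_def] pq
    by (simp add: emeasure_predictive_mixture[OF A] flip: distrib_left)
  \<comment> \<open>A common summand cancels in \<open>ennreal\<close> only when finite; both
    factors here are probabilities.\<close>
  moreover have "?M \<psi>\<^sub>0 * p \<noteq> \<top>"
    by (simp add: p_def ennreal_mult_eq_top_iff)
  ultimately have "I \<le> ?M \<psi>\<^sub>0 * q"
    by (simp add: ennreal_add_left_cancel_le)
  then have "I / q \<le> ?M \<psi>\<^sub>0 * q / q"
    by (rule divide_right_mono_ennreal)
  then show ?thesis
    using q by (simp add: I_def[symmetric] q_def[symmetric] ennreal_mult_divide_eq ennreal_times_divide
        ennreal_divide_times)
qed

end

theorem theorem3:
  fixes P :: "'t measure" and \<mu> :: "'x measure" and N :: "'p measure"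
    and f :: "'t \<Rightarrow> 'x \<Rightarrow> real" and Y :: "'t \<Rightarrow> 'p" and K :: "'p \<Rightarrow> 't measure"
  assumes model: "relative_belief_model P \<mu> N f Y K"
  shows
    "(\<forall>\<psi>\<^sub>0\<in>space N. emeasure (marginal_prior P N Y) {\<psi>\<^sub>0} < 1 \<longrightarrow>
        emeasure (predictive \<mu> f (K \<psi>\<^sub>0)) {x \<in> space \<mu>. rel_belief f P K \<psi>\<^sub>0 x > 1}
        \<ge> 1 / emeasure (marginal_prior P N Y) (space N - {\<psi>\<^sub>0}) *
          (\<integral>\<^sup>+\<psi>\<in>space N - {\<psi>\<^sub>0}.
             emeasure (predictive \<mu> f (K \<psi>)) {x \<in> space \<mu>. rel_belief f P K \<psi>\<^sub>0 x > 1}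
           \<partial>marginal_prior P N Y))
     \<and>
     ((\<forall>\<psi>\<^sub>0\<in>space N. emeasure (marginal_prior P N Y) {\<psi>\<^sub>0} < 1) \<longrightarrow>
        (\<integral>\<^sup>+\<psi>\<^sub>0. emeasure (predictive \<mu> f (K \<psi>\<^sub>0))
                  {x \<in> space \<mu>. \<psi>\<^sub>0 \<in> plausible_region f P N K x}
         \<partial>marginal_prior P N Y)
        \<ge> (\<integral>\<^sup>+\<psi>\<^sub>0. 1 / emeasure (marginal_prior P N Y) (space N - {\<psi>\<^sub>0}) *
              (\<integral>\<^sup>+\<psi>\<in>space N - {\<psi>\<^sub>0}.
                 emeasure (predictive \<mu> f (K \<psi>))
                   {x \<in> space \<mu>. \<psi>\<^sub>0 \<in> plausible_region f P N K x}
               \<partial>marginal_prior P N Y)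
           \<partial>marginal_prior P N Y))"
proof -
  interpret relative_belief_model P \<mu> N f Y K by (rule model)
  \<comment> \<open>With \<open>\<psi>\<^sub>0\<close> in \<open>space N\<close>, covering
    \<open>\<psi>\<^sub>0\<close> is the same event as evidence in its favor. The second claim is
    then the first one at each \<open>\<psi>\<^sub>0\<close>, integrated by monotonicity.\<close>
  have region: "{x \<in> space \<mu>. \<psi>\<^sub>0 \<in> plausible_region f P N K x} = {x \<in> space \<mu>. rel_belief f P K \<psi>\<^sub>0 x > 1}"
    if "\<psi>\<^sub>0 \<in> space N" for \<psi>\<^sub>0
    using that by (simp add: plausible_region_def)
  show ?thesis
    using evidence_in_favor_true_ge_false
    by (auto simp: region intro!: nn_integral_mono)
qed

end
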